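(* Let $n\ge 1$ be an integer, $0<\gamma<n$, $q=n/(n-\gamma)$ and $w\in A_{1,q}$. Assume that $1\le\alpha<\beta<s\le\infty$ with $1/\beta=1/\alpha-\gamma/n$, and that $\mu\in\Delta_2$. Then the fractional maximal operator $M_\gamma$ is bounded from $(L^1,L^s)^{\alpha}(w,w^q;\mu)$ into $(WL^q,L^s)^{\beta}(w^q;\mu)$; that is, there is a constant $C>0$ independent of $f$ such that $\|M_\gamma f\|_{(WL^q,L^s)^{\beta}(w^q;\mu)}\le C\|f\|_{(L^1,L^s)^{\alpha}(w,w^q;\mu)}$ for all $f\in(L^1,L^s)^{\alpha}(w,w^q;\mu)$.
   Context: A weight is a non-negative locally integrable function on $\mathbb R^n$; for a weight $w$ and measurable $E$, $w(E)=\int_E w(x)\,dx$, and $w^q(E)=\int_E w(x)^q\,dx$. $B(y,r)$ is the open Euclidean ball with center $y$ and radius $r$. Fractional maximal operator: $M_\gamma f(x)=\sup_{B\ni x}\frac1{|B|^{1-\gamma/n}}\int_B|f(y)|\,dy$, the supremum over all balls $B$ containing $x$. For $1<q<\infty$, $w\in A_{1,q}$ means: there is $C>0$ such that for every ball $B$, $\left(\frac1{|B|}\int_B w^q\,dx\right)^{1/q}\left(\operatorname{ess\,sup}_{x\in B}\frac1{w(x)}\right)\le C$. $\mu\in\Delta_2$ means that $\mu$ is a weight and there is $C>0$ with $\mu(2B)\le C\mu(B)$ for every ball $B$ ($2B$ is the concentric ball with twice the radius). Weighted amalgam spaces: for $1\le p\le\alpha\le s\le\infty$ and weights $\nu,w,\mu$,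 the space $(L^p,L^s)^{\alpha}(\nu,w;\mu)$ consists of all locally integrable $f$ with $$\|f\|_{(L^p,L^s)^{\alpha}(\nu,w;\mu)}:=\sup_{r>0}\Big\|w(B(y,r))^{1/\alpha-1/p-1/s}\,\|f\chi_{B(y,r)}\|_{L^p(\nu)}\Big\|_{L^s(\mu)}<\infty,$$ where the $L^s(\mu)$-norm (norm with respect to $\mu(y)\,dy$, usual modification when $s=\infty$) is taken in $y$, and $\|g\|_{L^p(\nu)}=(\int|g|^p\nu\,dx)^{1/p}$. The weak space $(WL^p,L^s)^{\alpha}(w;\mu)$ consists of all measurable $f$ with $$\|f\|_{(WL^p,L^s)^{\alpha}(w;\mu)}:=\sup_{r>0}\Big\|w(B(y,r))^{1/\alpha-1/p-1/s}\,\|f\chi_{B(y,r)}\|_{WL^p(w)}\Big\|_{L^s(\mu)}<\infty,$$ where $\|g\|_{WL^p(w)}=\sup_{\lambda>0}\lambda\,[w(\{x:|g(x)|>\lambda\})]^{1/p}$. *)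

theory Defs
  imports "HOL-Probability.Essential_Supremum"
begin

text \<open>Measurability and integrals refer to Lebesgue measure. Norms, averages and maximal
  functions take values in \<^typ>\<open>ennreal\<close>, where \<open>0 * \<infinity> = 0\<close> and \<open>inverse 0 = \<infinity>\<close>.\<close>

definition locally_integrable :: "('a::euclidean_space \<Rightarrow> 'b::{banach,second_countable_topology}) \<Rightarrow> bool"
  where "locally_integrable f \<longleftrightarrow> (\<forall>K. compact K \<longrightarrow> set_integrable lebesgue K f)"

definition weight :: "('a::euclidean_space \<Rightarrow> real) \<Rightarrow> bool"
  where "weight w \<longleftrightarrow> (\<forall>x. 0 \<le> w x) \<and> locally_integrable w"

text \<open>The measure \<open>w(x) dx\<close>, so that \<open>w(E)\<close> is \<open>emeasure (wmeasure w) E\<close>.\<close>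

definition wmeasure :: "('a::euclidean_space \<Rightarrow> real) \<Rightarrow> 'a measure"
  where "wmeasure w = density lebesgue (\<lambda>x. ennreal (w x))"

text \<open>Real powers on \<open>[0, \<infinity>]\<close>; negative powers of \<open>0\<close> are \<open>\<infinity>\<close> and \<open>x\<^sup>0 = 1\<close> for all \<open>x\<close>.\<close>

definition epowr :: "ennreal \<Rightarrow> real \<Rightarrow> ennreal"
  where "epowr x a =
    (if a = 0 then 1
     else if x = 0 then (if a < 0 then \<infinity> else 0)
     else if x = \<infinity> then (if a < 0 then 0 else \<infinity>)
     else ennreal (enn2real x powr a))"

text \<open>The number \<open>1/p\<close> for an exponent \<open>0 < p \<le> \<infinity>\<close>, with \<open>1/\<infinity> = 0\<close>.\<close>

definition recip :: "ennreal \<Rightarrow> real"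
  where "recip p = enn2real (inverse p)"

text \<open>The \<open>L\<^sup>p(\<nu>)\<close> norm of a function with absolute value \<open>g\<close>.\<close>

definition Lnorm :: "ennreal \<Rightarrow> ('a::euclidean_space \<Rightarrow> real) \<Rightarrow> ('a \<Rightarrow> ennreal) \<Rightarrow> ennreal"
  where "Lnorm p \<nu> g =
    (if p = \<infinity> then esssup (wmeasure \<nu>) g
     else epowr (\<integral>\<^sup>+ x. epowr (g x) (enn2real p) \<partial>wmeasure \<nu>) (recip p))"

text \<open>The weak \<open>L\<^sup>p(w)\<close> norm of a function with absolute value \<open>g\<close>.\<close>

definition WLnorm :: "real \<Rightarrow> ('a::euclidean_space \<Rightarrow> real) \<Rightarrow> ('a \<Rightarrow> ennreal) \<Rightarrow> ennreal"
  where "WLnorm p w g =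
    (SUP t\<in>{0<..}. ennreal t * epowr (emeasure (wmeasure w) {x. g x > ennreal t}) (1 / p))"

definition amalgam_norm ::
  "ennreal \<Rightarrow> ennreal \<Rightarrow> ennreal \<Rightarrow> ('a::euclidean_space \<Rightarrow> real) \<Rightarrow> ('a \<Rightarrow> real) \<Rightarrow> ('a \<Rightarrow> real)
    \<Rightarrow> ('a \<Rightarrow> 'b::real_normed_vector) \<Rightarrow> ennreal"
  where "amalgam_norm p s \<alpha> \<nu> w \<mu> f =
    (SUP r\<in>{0<..}. Lnorm s \<mu> (\<lambda>y.
       epowr (emeasure (wmeasure w) (ball y r)) (recip \<alpha> - recip p - recip s)
       * Lnorm p \<nu> (\<lambda>x. ennreal (norm (f x)) * indicator (ball y r) x)))"

definition amalgam ::
  "ennreal \<Rightarrow> ennreal \<Rightarrow> ennreal \<Rightarrow> ('a::euclidean_space \<Rightarrow> real) \<Rightarrow> ('a \<Rightarrow> real) \<Rightarrow> ('a \<Rightarrow> real)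
    \<Rightarrow> ('a \<Rightarrow> 'b::{banach,second_countable_topology}) set"
  where "amalgam p s \<alpha> \<nu> w \<mu> =
    {f. locally_integrable f \<and> amalgam_norm p s \<alpha> \<nu> w \<mu> f < \<infinity>}"

text \<open>The weak spaces are spaces of \<open>[0, \<infinity>]\<close>-valued functions, since they have to contain
  maximal functions, which are not known beforehand to be finite.\<close>

definition weak_amalgam_norm ::
  "real \<Rightarrow> ennreal \<Rightarrow> ennreal \<Rightarrow> ('a::euclidean_space \<Rightarrow> real) \<Rightarrow> ('a \<Rightarrow> real)
    \<Rightarrow> ('a \<Rightarrow> ennreal) \<Rightarrow> ennreal"
  where "weak_amalgam_norm p s \<alpha> w \<mu> g =
    (SUP r\<in>{0<..}. Lnorm s \<mu> (\<lambda>y.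
       epowr (emeasure (wmeasure w) (ball y r)) (recip \<alpha> - 1 / p - recip s)
       * WLnorm p w (\<lambda>x. g x * indicator (ball y r) x)))"

definition weak_amalgam ::
  "real \<Rightarrow> ennreal \<Rightarrow> ennreal \<Rightarrow> ('a::euclidean_space \<Rightarrow> real) \<Rightarrow> ('a \<Rightarrow> real)
    \<Rightarrow> ('a \<Rightarrow> ennreal) set"
  where "weak_amalgam p s \<alpha> w \<mu> =
    {g \<in> borel_measurable lebesgue. weak_amalgam_norm p s \<alpha> w \<mu> g < \<infinity>}"

definition frac_maximal :: "real \<Rightarrow> ('a::euclidean_space \<Rightarrow> 'b::real_normed_vector) \<Rightarrow> 'a \<Rightarrow> ennreal"
  where "frac_maximal \<gamma> f x =
    (SUP (z, r) \<in> {(z, r). 0 < r \<and> x \<in> ball z r}.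
       (\<integral>\<^sup>+ y \<in> ball z r. ennreal (norm (f y)) \<partial>lebesgue)
       / epowr (emeasure lebesgue (ball z r)) (1 - \<gamma> / real DIM('a)))"

definition A1_class :: "real \<Rightarrow> ('a::euclidean_space \<Rightarrow> real) set"
  where "A1_class q = {w. weight w \<and> (\<exists>C>0. \<forall>z. \<forall>r>0.
     epowr ((\<integral>\<^sup>+ x \<in> ball z r. ennreal (w x powr q) \<partial>lebesgue) / emeasure lebesgue (ball z r)) (1 / q)
     * esssup (restrict_space lebesgue (ball z r)) (\<lambda>x. inverse (ennreal (w x)))
     \<le> ennreal C)}"

definition doubling :: "('a::euclidean_space \<Rightarrow> real) set"
  where "doubling = {\<mu>. weight \<mu> \<and> (\<exists>C>0. \<forall>z. \<forall>r>0.
     emeasure (wmeasure \<mu>) (ball z (2 * r)) \<le> ennreal C * emeasure (wmeasure \<mu>) (ball z r))}"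

end

theory Submission
  imports Defs
begin

text \<open>Write \<open>M\<close> for the measure \<open>w\<^sup>q dx\<close> and \<open>P\<close> for \<open>|f| w dx\<close>. The \<open>A\<^bsub>1,q\<^esub>\<close> condition gives
  \<open>M(B') \<le> A (|B'|/|B|) M(B)\<close> for balls \<open>B \<subseteq> B'\<close>, hence doubling and reverse doubling of \<open>M\<close>, and it
  gives \<open>M(B) \<le> (C P(B) / t)\<^sup>q\<close> for every ball \<open>B\<close> on which the fractional average of \<open>|f|\<close> exceeds \<open>t\<close>.
  The part \<open>S\<close> of a ball \<open>B = B(y, r)\<close> on which the maximal function exceeds \<open>t\<close> is either covered by
  such balls of radius at most \<open>r/2\<close>, and Vitali's lemma bounds \<open>M(S)\<close> in terms of \<open>P(2B)\<close>, or it meets a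
  larger one, which is comparable to some \<open>2\<^sup>kB\<close>. In both cases there is a \<open>k\<close> with
  \<open>M(S) M(2\<^sup>kB) \<le> G M(B) (C P(2\<^sup>kB) / t)\<^sup>q\<close>. With \<open>e = 1/\<alpha> - 1 - 1/s = 1/\<beta> - 1/q - 1/s\<close>, reverse doubling
  bounds the local weak norm, multiplied by \<open>M(B)\<^sup>e\<close>, by a constant times the supremum over \<open>k\<close> of
  \<open>\<delta>\<^sup>k M(2\<^sup>kB)\<^sup>e P(2\<^sup>kB)\<close>, where \<open>\<delta> < 1\<close> because \<open>e + 1/q = 1/\<beta> - 1/s > 0\<close>. The \<open>s\<close>-th power of this
  supremum is at most the sum of the \<open>s\<close>-th powers, so the \<open>L\<^sup>s\<close> norms add up to a geometric series.\<close>

section \<open>Real powers on [0, \<infinity>]\<close>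

lemma epowr_0 [simp]: "0 < a \<Longrightarrow> epowr 0 a = 0"
  by (simp add: epowr_def)

lemma epowr_top [simp]: "0 < a \<Longrightarrow> epowr top a = top"
  by (simp add: epowr_def)

lemma epowr_ennreal: "0 < x \<Longrightarrow> epowr (ennreal x) a = ennreal (x powr a)"
  by (auto simp: epowr_def ennreal_eq_0_iff)

lemma epowr_ennreal_nonneg: "0 \<le> x \<Longrightarrow> 0 < a \<Longrightarrow> epowr (ennreal x) a = ennreal (x powr a)"
  by (cases "x = 0") (auto simp: epowr_ennreal)

lemma epowr_1 [simp]: "epowr x 1 = x"
  by (cases x) (auto simp: epowr_ennreal_nonneg)

lemma epowr_mono: "0 < a \<Longrightarrow> x \<le> y \<Longrightarrow> epowr x a \<le> epowr y a"
  by (cases x; cases y) (auto simp: epowr_ennreal_nonneg powr_mono2 top_unique intro!: ennreal_leI)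

text \<open>Positivity of \<open>a\<close> matters for the product of 0 and \<infinity>: a negative
  power would give \<infinity> on the left and 0 on the right.\<close>

lemma epowr_mult:
  assumes "0 < a" shows "epowr (x * y) a = epowr x a * epowr y a"
proof (cases x; cases y)
  fix s t :: real assume "0 \<le> s" "x = ennreal s" "0 \<le> t" "y = ennreal t"
  then show ?thesis using assms
    by (simp add: epowr_ennreal_nonneg powr_mult flip: ennreal_mult)
next
  fix s assume "0 \<le> s" "x = ennreal s" "y = top"
  then show ?thesis using assms
    by (cases "s = 0") (auto simp: epowr_ennreal ennreal_mult_top)
next
  fix t assume "0 \<le> t" "y = ennreal t" "x = top"
  then show ?thesis using assms
    by (cases "t = 0") (auto simp: epowr_ennreal ennreal_top_mult)
qed (use assms in auto)

lemma epowr_epowr: "0 < a \<Longrightarrow> 0 < b \<Longrightarrow> epowr (epowr x a) b = epowr x (a * b)"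
  by (cases x) (auto simp: epowr_ennreal_nonneg powr_powr)

text \<open>For positive \<open>a\<close> the powers \<open>a\<close> and \<open>1 / a\<close> are
  monotone and inverse to each other, also at 0 and \<infinity>.\<close>

lemma epowr_less_iff:
  assumes "0 < a" shows "x < epowr y a \<longleftrightarrow> epowr x (1 / a) < y"
proof -
  have "epowr (epowr x (1 / a)) a = x" "epowr (epowr y a) (1 / a) = y"
    using assms by (simp_all add: epowr_epowr)
  then have "epowr y a \<le> x \<longleftrightarrow> y \<le> epowr x (1 / a)"
    using epowr_mono[of a y "epowr x (1 / a)"] epowr_mono[of "1 / a" "epowr y a" x] assms by auto
  then show ?thesis by (simp flip: not_le)
qed

lemma epowr_add_one:
  assumes "0 < a" shows "epowr x (1 + a) = x * epowr x a"
proof (cases x)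
  case (real r)
  with assms show ?thesis
    by (cases "r = 0") (auto simp: epowr_ennreal powr_add simp flip: ennreal_mult)
qed (use assms in auto)

lemma borel_measurable_epowr [measurable]: "(\<lambda>x. epowr x a) \<in> borel_measurable borel"
  unfolding epowr_def by measurable

text \<open>Each term of a non-negative series is at most its sum. This replaces a supremum by a
  series, which can be integrated term by term.\<close>

lemma epowr_SUP_le:
  fixes u :: "nat \<Rightarrow> ennreal"
  assumes "0 < a" shows "epowr (SUP k. u k) a \<le> (\<Sum>k. epowr (u k) a)"
proof -
  have "u k \<le> epowr (\<Sum>k. epowr (u k) a) (1 / a)" for k
    using epowr_mono[of "1 / a" "epowr (u k) a" "\<Sum>k. epowr (u k) a"] assms
      sum_le_suminf[of "\<lambda>k. epowr (u k) a" "{k}"]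
    by (simp add: epowr_epowr)
  then have "(SUP k. u k) \<le> epowr (\<Sum>k. epowr (u k) a) (1 / a)"
    by (rule SUP_least)
  from epowr_mono[OF assms this] show ?thesis
    using assms by (simp add: epowr_epowr)
qed

section \<open>Countable unions and semicontinuity of the measure of balls\<close>

text \<open>The indicator of a union is at most the sum of the indicators. The sum is an integral
  over \<open>count_space I\<close> because Vitali families come as countable sets without an
  enumeration.\<close>

lemma emeasure_UN_le_nn_integral:
  assumes [measurable]: "\<And>i. i \<in> I \<Longrightarrow> X i \<in> sets M" and I: "countable I"
  shows "emeasure M (\<Union>i\<in>I. X i) \<le> (\<integral>\<^sup>+i. emeasure M (X i) \<partial>count_space I)"
proof -
  have [measurable]: "(\<Union>i\<in>I. X i) \<in> sets M"
    using assms by auto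
  have "emeasure M (\<Union>i\<in>I. X i) = (\<integral>\<^sup>+x. indicator (\<Union>i\<in>I. X i) x \<partial>M)"
    by simp
  also have "\<dots> \<le> (\<integral>\<^sup>+x. \<integral>\<^sup>+i. indicator (X i) x \<partial>count_space I \<partial>M)"
  proof (rule nn_integral_mono)
    fix x
    show "(indicator (\<Union>i\<in>I. X i) x :: ennreal) \<le> (\<integral>\<^sup>+i. indicator (X i) x \<partial>count_space I)"
    proof (cases "x \<in> (\<Union>i\<in>I. X i)")
      case True
      then obtain j where j: "j \<in> I" "x \<in> X j" by auto
      have "(1::ennreal) = (\<integral>\<^sup>+i. indicator {j} i \<partial>count_space I)"
        using j by simp
      also have "\<dots> \<le> (\<integral>\<^sup>+i. indicator (X i) x \<partial>count_space I)"
        using j by (intro nn_integral_mono) (auto simp: indicator_def)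
      finally show ?thesis using True by simp
    qed simp
  qed
  also have "\<dots> = (\<integral>\<^sup>+i. emeasure M (X i) \<partial>count_space I)"
    by (subst nn_integral_count_space_nn_integral[OF I]) (auto intro!: nn_integral_cong)
  finally show ?thesis .
qed

text \<open>By continuity from below, a slightly smaller concentric ball still meets
  \<open>S\<close> in measure above \<open>c\<close>, and it lies in every ball of radius
  \<open>r\<close> whose centre is close enough to \<open>y\<close>.\<close>

lemma open_emeasure_Int_ball_greater:
  fixes N :: "'a::euclidean_space measure"
  assumes sets: "sets N = sets lebesgue" and S: "S \<in> sets lebesgue"
  shows "open {y. c < emeasure N (S \<inter> ball y r)}"
proof (rule openI, clarify)
  fix y assume c: "c < emeasure N (S \<inter> ball y r)"
  define X where "X n = S \<inter> ball y (r - 1 / real (Suc n))" for n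
  have "range X \<subseteq> sets N"
    using S by (auto simp: X_def sets)
  moreover have "incseq X"
  proof (intro incseq_SucI)
    fix n
    have "1 / real (Suc (Suc n)) \<le> 1 / real (Suc n)" by (intro frac_le) auto
    then show "X n \<le> X (Suc n)" unfolding X_def by (intro Int_mono subset_ball) auto
  qed
  moreover have "(\<Union>n. X n) = S \<inter> ball y r"
  proof -
    have "\<exists>n. dist y x < r - 1 / real (Suc n)" if "dist y x < r" for x
      using reals_Archimedean[of "r - dist y x"] that by (auto simp: inverse_eq_divide algebra_simps)
    moreover have "dist y x < r" if "dist y x < r - 1 / real (Suc n)" for x n
      using that by (smt (verit) divide_nonneg_nonneg of_nat_0_le_iff)
    ultimately show ?thesis by (fastforce simp: X_def)
  qed
  ultimately have "c < (SUP n. emeasure N (X n))"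
    using c by (simp add: SUP_emeasure_incseq)
  then obtain n where n: "c < emeasure N (X n)"
    by (auto simp: less_SUP_iff)
  have "c < emeasure N (S \<inter> ball z r)" if "z \<in> ball y (1 / real (Suc n))" for z
  proof -
    have "X n \<subseteq> S \<inter> ball z r"
    proof
      fix x assume "x \<in> X n"
      with that dist_triangle[of z x y] show "x \<in> S \<inter> ball z r"
        by (auto simp: X_def dist_commute)
    qed
    then have "emeasure N (X n) \<le> emeasure N (S \<inter> ball z r)"
      using S by (intro emeasure_mono) (auto simp: sets)
    with n show ?thesis by simp
  qed
  then show "\<exists>e>0. ball y e \<subseteq> {y. c < emeasure N (S \<inter> ball y r)}"
    by (intro exI[of _ "1 / real (Suc n)"]) auto
qed

lemma borel_measurable_emeasure_ball:
  fixes N :: "'a::euclidean_space measure"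
  assumes "sets N = sets lebesgue"
  shows "(\<lambda>y. emeasure N (ball y r)) \<in> borel_measurable borel"
  using open_emeasure_Int_ball_greater[OF assms, of UNIV _ r]
  by (intro borel_measurableI_greater) auto

lemma open_sets_lebesgue: "open S \<Longrightarrow> S \<in> sets lebesgue"
  by (intro sets_completionI_sets) simp

section \<open>Measures with comparable balls\<close>

text \<open>Isolates what the covering argument uses of w^q dx. \<open>measure_ball_le\<close> is an
  A_1 type condition: the average density in a ball is at most \<open>A\<close> times that in any
  ball inside it. Concentric balls give doubling.\<close>

locale homogeneous_measure =
  fixes M :: "'a::euclidean_space measure" and A :: real
  assumes sets_M: "sets M = sets lebesgue"
    and finite_ball: "emeasure M (ball z r) < \<infinity>"
    and pos_ball: "0 < r \<Longrightarrow> 0 < emeasure M (ball z r)"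
    and A_pos: "0 < A"
    and measure_ball_le: "0 < \<rho> \<Longrightarrow> 0 < r \<Longrightarrow> ball z \<rho> \<subseteq> ball y r \<Longrightarrow>
      measure M (ball y r) \<le> A * (r / \<rho>) ^ DIM('a) * measure M (ball z \<rho>)"
begin

lemma emeasure_ball_eq: "emeasure M (ball z r) = ennreal (measure M (ball z r))"
  using finite_ball[of z r] by (intro emeasure_eq_ennreal_measure) auto

lemma measure_ball_pos: "0 < r \<Longrightarrow> 0 < measure M (ball z r)"
  using pos_ball[of r z] by (simp add: emeasure_ball_eq)

lemma emeasure_ball_le:
  assumes "0 < \<rho>" "ball z \<rho> \<subseteq> ball y r" "r \<le> L * \<rho>"
  shows "emeasure M (ball y r) \<le> ennreal (A * L ^ DIM('a)) * emeasure M (ball z \<rho>)"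
proof (cases "0 < r")
  case True
  have "measure M (ball y r) \<le> A * (r / \<rho>) ^ DIM('a) * measure M (ball z \<rho>)"
    using assms True by (intro measure_ball_le)
  also have "\<dots> \<le> A * L ^ DIM('a) * measure M (ball z \<rho>)"
    using assms True A_pos
    by (intro mult_right_mono mult_left_mono power_mono) (auto simp: field_simps)
  finally have "ennreal (measure M (ball y r)) \<le> ennreal (A * L ^ DIM('a) * measure M (ball z \<rho>))"
    by (rule ennreal_leI)
  then show ?thesis
    by (simp add: emeasure_ball_eq ennreal_mult'')
qed (simp add: not_less ball_empty)

text \<open>The shell between the radii \<open>r\<close> and \<open>2 * r\<close> contains a ball
  that carries a fixed fraction of the measure of the larger ball, and the smaller ball misses this
  fraction. Iteration gives the powers of \<theta>.\<close>

lemma reverse_doubling: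
  obtains \<theta> where "0 < \<theta>" "\<theta> < 1"
    "\<And>y r k. 0 < r \<Longrightarrow> measure M (ball y r) \<le> \<theta> ^ k * measure M (ball y (2 ^ k * r))"
proof
  \<comment> \<open>The 4 is the ratio of the radii \<open>2 * r\<close> and
    \<open>r / 2\<close>.\<close>
  define K where "K = A * 4 ^ DIM('a)"
  have K: "0 < K" using A_pos by (simp add: K_def)
  have two: "K * measure M (ball y r) \<le> (K - 1) * measure M (ball y (2 * r))" if r: "0 < r" for y r
  proof -
    obtain b :: 'a where b: "norm b = 1"
      using vector_choose_size[of 1] by auto
    \<comment> \<open>At this distance the ball of radius \<open>r / 2\<close> just fits into the
      shell.\<close>
    define z where "z = y + (3 * r / 2) *\<^sub>R b"
    have yz: "dist y z = 3 * r / 2"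
      using b r by (simp add: z_def dist_norm)
    have sub: "ball z (r / 2) \<subseteq> ball y (2 * r)"
    proof
      fix x assume "x \<in> ball z (r / 2)"
      with dist_triangle[of y x z] yz show "x \<in> ball y (2 * r)" by auto
    qed
    have disj: "ball y r \<inter> ball z (r / 2) = {}"
    proof -
      have False if "dist y x < r" "dist z x < r / 2" for x
        using dist_triangle[of y z x] yz that by (simp add: dist_commute)
      then show ?thesis by auto
    qed
    have "measure M (ball y (2 * r)) \<le> K * measure M (ball z (r / 2))"
      using measure_ball_le[of "r / 2" "2 * r" z y] sub r by (simp add: K_def)
    moreover have "measure M (ball y r) + measure M (ball z (r / 2)) \<le> measure M (ball y (2 * r))"
    proof -
      have "measure M (ball y r) + measure M (ball z (r / 2)) = measure M (ball y r \<union> ball z (r / 2))"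
        using disj finite_ball by (intro measure_Union[symmetric]) (auto simp: sets_M less_top)
      also have "\<dots> \<le> measure M (ball y (2 * r))"
        using sub r finite_ball by (intro measure_mono_fmeasurable) (auto simp: sets_M fmeasurable_def)
      finally show ?thesis .
    qed
    ultimately have "K * (measure M (ball y r) + measure M (ball z (r / 2))) \<le> K * measure M (ball y (2 * r))"
      using K by (intro mult_left_mono) auto
    with \<open>measure M (ball y (2 * r)) \<le> K * measure M (ball z (r / 2))\<close> show ?thesis
      by (simp add: algebra_simps)
  qed
  \<comment> \<open>The left side of \<open>two\<close> is positive, which forces \<open>K\<close>
    above 1 and hence the ratio \<open>(K - 1) / K\<close> to be positive.\<close>
  have "0 < (K - 1) * measure M (ball (0::'a) (2 * 1))"
    using two[of 1 0] measure_ball_pos[of 1 0] K by (smt (verit) mult_pos_pos)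
  then have K1: "1 < K"
    using measure_ball_pos[of "2 * 1" 0] by (simp add: zero_less_mult_iff)
  define \<theta> where "\<theta> = (K - 1) / K"
  show "0 < (K - 1) / K" "(K - 1) / K < 1" using K1 by auto
  have step: "measure M (ball y r) \<le> \<theta> * measure M (ball y (2 * r))" if "0 < r" for y r
    using two[OF that, of y] K by (simp add: \<theta>_def field_simps)
  show "measure M (ball y r) \<le> ((K - 1) / K) ^ k * measure M (ball y (2 ^ k * r))"
    if "0 < r" for y r k
    unfolding \<theta>_def[symmetric]
  proof (induction k)
    case (Suc k)
    have "measure M (ball y (2 ^ k * r)) \<le> \<theta> * measure M (ball y (2 * (2 ^ k * r)))"
      using that by (intro step) auto
    then have "\<theta> ^ k * measure M (ball y (2 ^ k * r)) \<le> \<theta> ^ k * (\<theta> * measure M (ball y (2 ^ Suc k * r)))"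
      using K1 by (intro mult_left_mono) (auto simp: \<theta>_def mult.assoc)
    with Suc show ?case by (simp add: mult_ac)
  qed simp
qed

text \<open>Vitali's lemma, for radii bounded by \<open>R\<close>, selects disjoint balls whose
  fivefold dilates cover the union. The q-th power splits into a first power, summed over the
  disjoint balls, and a power q - 1, in which the ball is replaced by \<open>U\<close>.\<close>

lemma emeasure_UN_small_balls_le:
  fixes K :: "('a \<times> real) set"
  assumes sets_P: "sets P = sets lebesgue" and q: "1 < q" and U: "U \<in> sets lebesgue"
    and K: "\<And>z \<rho>. (z, \<rho>) \<in> K \<Longrightarrow> 0 < \<rho> \<and> \<rho> \<le> R \<and> ball z \<rho> \<subseteq> U \<and>
      emeasure M (ball z \<rho>) \<le> epowr (c * emeasure P (ball z \<rho>)) q"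
  shows "emeasure M (\<Union>(z, \<rho>)\<in>K. ball z \<rho>) \<le> ennreal (A * 5 ^ DIM('a)) * epowr (c * emeasure P U) q"
proof -
  define B where "B i = ball (fst i) (snd i :: real)" for i :: "'a \<times> real"
  obtain C where C: "countable C" "C \<subseteq> K"
    "pairwise (\<lambda>i j. disjnt (cball (fst i) (snd i)) (cball (fst j) (snd j))) C"
    "\<And>i. i \<in> K \<Longrightarrow> \<exists>j. j \<in> C \<and> \<not> disjnt (cball (fst i) (snd i)) (cball (fst j) (snd j)) \<and>
        cball (fst i) (snd i) \<subseteq> ball (fst j) (5 * snd j)"
    by (rule Vitali_covering_lemma_cballs_balls[of K snd R fst]) (use K in \<open>auto\<close>)
  have disj: "disjoint_family_on B C"
    unfolding disjoint_family_on_def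
  proof (intro ballI impI)
    fix i j assume "i \<in> C" "j \<in> C" "i \<noteq> j"
    with C(3) have "disjnt (cball (fst i) (snd i)) (cball (fst j) (snd j))"
      by (auto simp: pairwise_def)
    then show "B i \<inter> B j = {}"
      by (auto simp: B_def disjnt_iff) (meson less_imp_le)
  qed
  let ?S = "c * emeasure P U"
  have BU: "B i \<subseteq> U" if "i \<in> C" for i
    using K[of "fst i" "snd i"] C(2) that by (auto simp: B_def)
  have "emeasure M (\<Union>(z, \<rho>)\<in>K. ball z \<rho>) \<le> emeasure M (\<Union>j\<in>C. ball (fst j) (5 * snd j))"
  proof (rule emeasure_mono)
    show "(\<Union>(z, \<rho>)\<in>K. ball z \<rho>) \<subseteq> (\<Union>j\<in>C. ball (fst j) (5 * snd j))"
      using C(4) ball_subset_cball by fastforce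
    show "(\<Union>j\<in>C. ball (fst j) (5 * snd j)) \<in> sets M"
      by (auto simp: sets_M intro!: open_sets_lebesgue open_UN)
  qed
  also have "\<dots> \<le> (\<integral>\<^sup>+j. emeasure M (ball (fst j) (5 * snd j)) \<partial>count_space C)"
    using C(1) by (intro emeasure_UN_le_nn_integral) (auto simp: sets_M)
  also have "\<dots> \<le> (\<integral>\<^sup>+j. ennreal (A * 5 ^ DIM('a)) * (epowr ?S (q - 1) * (c * emeasure P (B j))) \<partial>count_space C)"
  proof (rule nn_integral_mono)
    fix j assume j: "j \<in> space (count_space C)"
    then have "(fst j, snd j) \<in> K" using C(2) by auto
    note Kj = K[OF this]
    have "emeasure M (B j) \<le> epowr (c * emeasure P (B j)) (1 + (q - 1))"
      using Kj by (simp add: B_def)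
    also have "\<dots> = c * emeasure P (B j) * epowr (c * emeasure P (B j)) (q - 1)"
      using q by (intro epowr_add_one) auto
    also have "\<dots> \<le> c * emeasure P (B j) * epowr ?S (q - 1)"
      using q U BU[of j] j by (intro mult_left_mono epowr_mono emeasure_mono) (auto simp: sets_P)
    finally have "emeasure M (B j) \<le> epowr ?S (q - 1) * (c * emeasure P (B j))"
      by (simp add: mult_ac)
    moreover have "emeasure M (ball (fst j) (5 * snd j)) \<le> ennreal (A * 5 ^ DIM('a)) * emeasure M (B j)"
      using Kj unfolding B_def by (intro emeasure_ball_le) (auto intro!: subset_ball)
    ultimately show "emeasure M (ball (fst j) (5 * snd j)) \<le>
        ennreal (A * 5 ^ DIM('a)) * (epowr ?S (q - 1) * (c * emeasure P (B j)))"
      by (meson mult_left_mono order_trans zero_le)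
  qed
  \<comment> \<open>Disjointness turns the sum of the \<open>P\<close> measures into the measure of
    the union.\<close>
  also have "\<dots> = ennreal (A * 5 ^ DIM('a)) * (epowr ?S (q - 1) * (c * emeasure P (\<Union>j\<in>C. B j)))"
    using C(1) disj by (subst emeasure_UN_countable) (auto simp: nn_integral_cmult sets_P B_def)
  also have "\<dots> \<le> ennreal (A * 5 ^ DIM('a)) * (epowr ?S (q - 1) * ?S)"
    using U BU by (intro mult_left_mono emeasure_mono) (auto simp: sets_P)
  also have "epowr ?S (q - 1) * ?S = epowr ?S q"
    using epowr_add_one[of "q - 1" ?S] q by (simp add: mult_ac)
  finally show ?thesis .
qed

text \<open>The product on the left serves two cases with opposite pairings, where B is
  \<open>ball y r\<close>. If a ball of radius above \<open>r / 2\<close> occurs, M(S) is bounded by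
  M(B) and the dilated ball by the q-th power; otherwise M(2B) is bounded by M(B), and M(S) by the
  q-th power.\<close>

lemma emeasure_mult_dilated_ball_le:
  assumes sets_P: "sets P = sets lebesgue" and q: "1 < q" and r: "0 < r" and S: "S \<subseteq> ball y r"
    and cover: "\<And>x. x \<in> S \<Longrightarrow> \<exists>z \<rho>. 0 < \<rho> \<and> x \<in> ball z \<rho> \<and>
      emeasure M (ball z \<rho>) \<le> epowr (c * emeasure P (ball z \<rho>)) q"
  shows "\<exists>k. emeasure M S * emeasure M (ball y (2 ^ k * r)) \<le>
    ennreal (A * 8 ^ DIM('a) * (1 + A * 5 ^ DIM('a))) * emeasure M (ball y r) *
      epowr (c * emeasure P (ball y (2 ^ k * r))) q"
proof -
  define D E where "D = A * 8 ^ DIM('a)" and "E = A * 5 ^ DIM('a)"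
  have DE: "0 < D" "0 < E" using A_pos by (simp_all add: D_def E_def)
  define Q where "Q k = epowr (c * emeasure P (ball y (2 ^ k * r))) q" for k
  have S_le: "emeasure M S \<le> emeasure M (ball y r)"
    using S by (intro emeasure_mono) (auto simp: sets_M)
  have "\<exists>k. emeasure M S * emeasure M (ball y (2 ^ k * r)) \<le>
      ennreal (D * (1 + E)) * emeasure M (ball y r) * Q k"
  proof (cases "\<exists>x\<in>S. \<exists>z \<rho>. r / 2 < \<rho> \<and> x \<in> ball z \<rho> \<and>
      emeasure M (ball z \<rho>) \<le> epowr (c * emeasure P (ball z \<rho>)) q")
    case True
    then obtain x z \<rho> where x: "x \<in> S" "r / 2 < \<rho>" "x \<in> ball z \<rho>"
      "emeasure M (ball z \<rho>) \<le> epowr (c * emeasure P (ball z \<rho>)) q"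
      by blast
    \<comment> \<open>The ball around \<open>z\<close> contains \<open>x\<close>, so its points have
      distance less than \<open>r + 2 * \<rho>\<close> from \<open>y\<close>; this is the least
      dilate that reaches so far.\<close>
    define k where "k = (LEAST k. r + 2 * \<rho> \<le> 2 ^ k * r)"
    have ex: "\<exists>k. r + 2 * \<rho> \<le> 2 ^ k * r"
      using real_arch_pow[of 2 "(r + 2 * \<rho>) / r"] r by (auto simp: field_simps intro: less_imp_le)
    have k: "r + 2 * \<rho> \<le> 2 ^ k * r"
      unfolding k_def by (rule LeastI_ex[OF ex])
    have "k \<noteq> 0"
      using k x(2) r by (intro notI) simp
    then obtain j where j: "k = Suc j" by (cases k) auto
    have "\<not> r + 2 * \<rho> \<le> 2 ^ j * r"
      using not_less_Least[of j "\<lambda>k. r + 2 * \<rho> \<le> 2 ^ k * r"] j by (simp add: k_def)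
    \<comment> \<open>Minimality gives 2^k r < 2r + 4\<rho>, and r < 2\<rho> makes this less than
      8\<rho>: the origin of the 8 in \<open>D\<close>.\<close>
    then have k8: "2 ^ k * r \<le> 8 * \<rho>"
      using x(2) unfolding j power_Suc mult.assoc by linarith
    have sub: "ball z \<rho> \<subseteq> ball y (2 ^ k * r)"
    proof
      fix u assume "u \<in> ball z \<rho>"
      then show "u \<in> ball y (2 ^ k * r)"
        using dist_triangle[of y u x] dist_triangle[of x u z] x(1,3) S k by (force simp: dist_commute)
    qed
    have "emeasure M (ball y (2 ^ k * r)) \<le> ennreal D * emeasure M (ball z \<rho>)"
      unfolding D_def using k8 sub x(2) r by (intro emeasure_ball_le) auto
    also have "\<dots> \<le> ennreal D * epowr (c * emeasure P (ball z \<rho>)) q"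
      using x(4) by (intro mult_left_mono) auto
    also have "\<dots> \<le> ennreal D * Q k"
      unfolding Q_def using sub q by (intro mult_left_mono epowr_mono emeasure_mono) (auto simp: sets_P)
    \<comment> \<open>The constant is enlarged so that both cases share it.\<close>
    also have "\<dots> \<le> ennreal (D * (1 + E)) * Q k"
      using DE by (intro mult_right_mono ennreal_leI) auto
    finally have "emeasure M S * emeasure M (ball y (2 ^ k * r)) \<le>
        emeasure M (ball y r) * (ennreal (D * (1 + E)) * Q k)"
      using S_le by (intro mult_mono) auto
    then show ?thesis by (intro exI[of _ k]) (simp add: mult_ac)
  next
    case False
    let ?K = "{(z, \<rho>). 0 < \<rho> \<and> \<rho> \<le> r / 2 \<and> ball z \<rho> \<subseteq> ball y (2 * r) \<and>
      emeasure M (ball z \<rho>) \<le> epowr (c * emeasure P (ball z \<rho>)) q}"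
    have "S \<subseteq> (\<Union>(z, \<rho>)\<in>?K. ball z \<rho>)"
    proof
      fix x assume x: "x \<in> S"
      then obtain z \<rho> where z: "0 < \<rho>" "x \<in> ball z \<rho>"
        "emeasure M (ball z \<rho>) \<le> epowr (c * emeasure P (ball z \<rho>)) q"
        using cover by blast
      with False x have "\<rho> \<le> r / 2" by force
      \<comment> \<open>Points of the ball are within 2\<rho> \<le> r of \<open>x\<close>, which
        explains the threshold \<open>r / 2\<close>.\<close>
      moreover have "ball z \<rho> \<subseteq> ball y (2 * r)"
      proof
        fix u assume "u \<in> ball z \<rho>"
        then show "u \<in> ball y (2 * r)"
          using dist_triangle[of y u x] dist_triangle[of x u z] x z(2) S \<open>\<rho> \<le> r / 2\<close>
          by (force simp: dist_commute)
      qed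
      ultimately show "x \<in> (\<Union>(z, \<rho>)\<in>?K. ball z \<rho>)" using z by auto
    qed
    then have "emeasure M S \<le> emeasure M (\<Union>(z, \<rho>)\<in>?K. ball z \<rho>)"
      by (intro emeasure_mono) (auto simp: sets_M intro!: open_sets_lebesgue open_UN)
    also have "\<dots> \<le> ennreal E * epowr (c * emeasure P (ball y (2 * r))) q"
      unfolding E_def using q by (intro emeasure_UN_small_balls_le[OF sets_P, of _ _ _ "r / 2"]) auto
    also have "\<dots> \<le> ennreal (1 + E) * Q 1"
      unfolding Q_def using DE by (intro mult_mono ennreal_leI) auto
    finally have 1: "emeasure M S \<le> ennreal (1 + E) * Q 1" .
    have 2: "emeasure M (ball y (2 ^ 1 * r)) \<le> ennreal D * emeasure M (ball y r)"
      unfolding D_def using r by (intro emeasure_ball_le subset_ball) auto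
    have "emeasure M S * emeasure M (ball y (2 ^ 1 * r)) \<le>
        (ennreal (1 + E) * Q 1) * (ennreal D * emeasure M (ball y r))"
      using 1 2 by (intro mult_mono) auto
    also have "\<dots> = ennreal (D * (1 + E)) * emeasure M (ball y r) * Q 1"
      using DE by (simp add: ennreal_mult mult_ac)
    finally show ?thesis by blast
  qed
  then show ?thesis by (simp add: Q_def D_def E_def)
qed

text \<open>The ratio of the measures of the two balls enters with the power \<open>e + 1 / q\<close>, which turns
  reverse doubling into geometric decay.\<close>

lemma scaled_level_le:
  assumes q: "0 < q" and r: "0 < r" and e: "0 < e + 1 / q" and G: "0 \<le> G" and t: "0 < t" and C: "0 \<le> C"
    and \<theta>: "0 < \<theta>" "measure M (ball y r) \<le> \<theta> ^ k * measure M (ball y (2 ^ k * r))"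
    and le: "emeasure M S * emeasure M (ball y (2 ^ k * r)) \<le>
      ennreal G * emeasure M (ball y r) * epowr (ennreal (C / t) * Pk) q"
  shows "epowr (emeasure M (ball y r)) e * (ennreal t * epowr (emeasure M S) (1 / q)) \<le>
    ennreal (G powr (1 / q) * C) * (ennreal (\<theta> powr (e + 1 / q)) ^ k *
      (epowr (emeasure M (ball y (2 ^ k * r))) e * Pk))"
proof -
  define m mk where "m = measure M (ball y r)" and "mk = measure M (ball y (2 ^ k * r))"
  have m: "0 < m" "0 < mk" "emeasure M (ball y r) = ennreal m" "emeasure M (ball y (2 ^ k * r)) = ennreal mk"
    using r by (simp_all add: m_def mk_def measure_ball_pos emeasure_ball_eq)
  define X where "X = epowr (emeasure M S) (1 / q)"
  \<comment> \<open>The q-th root of \<open>le\<close>. \<open>X\<close> and \<open>Pk\<close> stay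
    in \<open>ennreal\<close>, as they may be infinite.\<close>
  have "X * ennreal (mk powr (1 / q)) \<le> ennreal (G powr (1 / q)) * ennreal (m powr (1 / q)) * (ennreal (C / t) * Pk)"
    using epowr_mono[OF _ le, of "1 / q"] q m G
    by (simp add: epowr_mult epowr_epowr epowr_ennreal_nonneg X_def)
  \<comment> \<open>The new factor cancels the power of \<open>mk\<close> on the left and supplies
    \<open>m powr e\<close> and \<open>t\<close>.\<close>
  then have "X * ennreal (mk powr (1 / q)) * ennreal (mk powr (- 1 / q) * m powr e * t) \<le>
     ennreal (G powr (1 / q)) * ennreal (m powr (1 / q)) * (ennreal (C / t) * Pk) * ennreal (mk powr (- 1 / q) * m powr e * t)"
    by (rule mult_right_mono) auto
  also have "ennreal (mk powr (- 1 / q) * m powr e * t) = ennreal (mk powr (- 1 / q)) * ennreal (m powr e) * ennreal t"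
    using t by (simp add: ennreal_mult)
  also have "X * ennreal (mk powr (1 / q)) * (ennreal (mk powr (- 1 / q)) * ennreal (m powr e) * ennreal t) =
    (ennreal (mk powr (1 / q)) * ennreal (mk powr (- 1 / q))) * (ennreal (m powr e) * (ennreal t * X))"
    by (simp add: mult_ac)
  also have "ennreal (mk powr (1 / q)) * ennreal (mk powr (- 1 / q)) = 1"
    using m by (simp flip: ennreal_mult powr_add)
  also have "ennreal (G powr (1 / q)) * ennreal (m powr (1 / q)) * (ennreal (C / t) * Pk) *
      (ennreal (mk powr (- 1 / q)) * ennreal (m powr e) * ennreal t) =
    (ennreal (G powr (1 / q)) * ennreal (C / t) * ennreal t) *
      ((ennreal (m powr (1 / q)) * ennreal (m powr e) * ennreal (mk powr (- 1 / q))) * Pk)"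
    by (simp add: mult_ac)
  also have "ennreal (G powr (1 / q)) * ennreal (C / t) * ennreal t = ennreal (G powr (1 / q) * C)"
    using t C by (simp flip: ennreal_mult)
  also have "ennreal (m powr (1 / q)) * ennreal (m powr e) * ennreal (mk powr (- 1 / q)) =
      ennreal ((m / mk) powr (e + 1 / q) * mk powr e)"
  proof -
    \<comment> \<open>Writing -1/q as e - (e + 1/q) separates the ratio \<open>m / mk\<close> from
      the normalising power of the larger ball.\<close>
    have "m powr (1 / q) * m powr e * mk powr (- 1 / q) = m powr (e + 1 / q) * mk powr (e - (e + 1 / q))"
      by (simp add: mult_ac flip: powr_add)
    moreover have "mk powr (e - (e + 1 / q)) = mk powr e / mk powr (e + 1 / q)"
      by (rule powr_diff)
    ultimately have "m powr (1 / q) * m powr e * mk powr (- 1 / q) = (m / mk) powr (e + 1 / q) * mk powr e"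
      using m by (simp add: powr_divide)
    then show ?thesis
      by (simp flip: ennreal_mult)
  qed
  also have "\<dots> \<le> ennreal ((\<theta> powr (e + 1 / q)) ^ k * mk powr e)"
  proof (intro ennreal_leI mult_right_mono)
    have "(m / mk) powr (e + 1 / q) \<le> (\<theta> ^ k) powr (e + 1 / q)"
      using \<theta>(2) m e by (intro powr_mono2) (auto simp: m_def mk_def field_simps)
    also have "\<dots> = (\<theta> powr (e + 1 / q)) ^ k"
      using \<theta>(1) by (simp add: powr_powr mult_ac flip: powr_realpow)
    finally show "(m / mk) powr (e + 1 / q) \<le> (\<theta> powr (e + 1 / q)) ^ k" .
  qed auto
  also have "ennreal ((\<theta> powr (e + 1 / q)) ^ k * mk powr e) * Pk =
      ennreal (\<theta> powr (e + 1 / q)) ^ k * (ennreal (mk powr e) * Pk)"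
    by (simp add: ennreal_mult ennreal_power mult_ac)
  finally show ?thesis
    using m by (simp add: epowr_ennreal X_def mult_left_mono mult_right_mono)
qed

end

section \<open>Norms of suprema with geometric decay\<close>

text \<open>Since \<open>k\<close> runs over the natural numbers, the exceptional null sets unite to
  a null set.\<close>

lemma esssup_le_SUP:
  assumes "F \<in> borel_measurable N" "\<And>y. F y \<le> ennreal H * (SUP k::nat. u k y)"
    "\<And>k. esssup N (u k) \<le> K"
  shows "esssup N F \<le> ennreal H * K"
proof (rule esssup_I[OF assms(1)])
  have "AE y in N. \<forall>k. u k y \<le> K"
    unfolding AE_all_countable
  proof
    fix k show "AE y in N. u k y \<le> K"
      using esssup_AE[where M = N and f = "u k"] by eventually_elim (use assms(3)[of k] in order)
  qed
  then show "AE y in N. F y \<le> ennreal H * K"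
  proof eventually_elim
    case (elim y)
    then have "ennreal H * (SUP k. u k y) \<le> ennreal H * K"
      by (intro mult_left_mono SUP_least) auto
    with assms(2)[of y] show ?case by order
  qed
qed

text \<open>For finite \<open>s\<close> the s-th power of the supremum is at most the sum of the
  s-th powers, whose integrals form a geometric series. \<open>C\<close> is fixed before
  \<open>F\<close>, \<open>a\<close> and \<open>K\<close>, so it will be uniform in the function and
  the radius.\<close>

lemma Lnorm_le_geometric_SUP:
  fixes \<mu> :: "'a::euclidean_space \<Rightarrow> real"
  assumes s: "0 < s" and \<theta>: "0 \<le> \<theta>" "\<theta> < 1" and H: "0 < H"
  obtains C where "0 < C"
    "\<And>F a K. F \<in> borel_measurable lebesgue \<Longrightarrow> (\<And>k. a k \<in> borel_measurable lebesgue) \<Longrightarrow>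
      (\<And>y. F y \<le> ennreal H * (SUP k::nat. ennreal \<theta> ^ k * a k y)) \<Longrightarrow>
      (\<And>k. Lnorm s \<mu> (a k) \<le> K) \<Longrightarrow> Lnorm s \<mu> F \<le> ennreal C * K"
proof (cases s)
  case top
  have *: "Lnorm s \<mu> F \<le> ennreal H * K"
    if F: "F \<in> borel_measurable lebesgue" and a: "\<And>k. a k \<in> borel_measurable lebesgue"
      and le: "\<And>y. F y \<le> ennreal H * (SUP k::nat. ennreal \<theta> ^ k * a k y)"
      and K: "\<And>k. Lnorm s \<mu> (a k) \<le> K" for F K and a :: "nat \<Rightarrow> 'a \<Rightarrow> ennreal"
  proof -
    \<comment> \<open>For the essential supremum the bound \<theta>^k \<le> 1 suffices.\<close>
    have "ennreal \<theta> ^ k * a k y \<le> a k y" for k y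
      using \<theta> mult_right_mono[of "ennreal \<theta> ^ k" 1 "a k y"]
      by (simp add: ennreal_power power_le_one)
    then have "(SUP k. ennreal \<theta> ^ k * a k y) \<le> (SUP k. a k y)" for y
      by (intro SUP_mono) blast
    then have "F y \<le> ennreal H * (SUP k. a k y)" for y
      using le[of y] by (meson mult_left_mono order_trans zero_le)
    moreover have "F \<in> borel_measurable (wmeasure \<mu>)"
      using F by (simp add: wmeasure_def)
    ultimately show ?thesis
      using esssup_le_SUP[of F "wmeasure \<mu>" H a K] K top by (simp add: Lnorm_def)
  qed
  show ?thesis by (rule that[OF H]) (fact *)
next
  case (real \<sigma>)
  with s have \<sigma>: "0 < \<sigma>" by auto
  have rs: "recip s = 1 / \<sigma>"
    using \<sigma> real by (simp add: recip_def inverse_ennreal inverse_eq_divide)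
  define \<rho> where "\<rho> = \<theta> powr \<sigma>"
  have \<rho>: "0 \<le> \<rho>" "\<rho> < 1"
    using \<theta> \<sigma> powr_less_mono2[of \<sigma> \<theta> 1] by (auto simp: \<rho>_def)
  \<comment> \<open>The \<sigma>-th root of \<open>H powr \<sigma>\<close> times the sum of the
    geometric series.\<close>
  define C where "C = H * (1 / (1 - \<rho>)) powr (1 / \<sigma>)"
  have C: "0 < C" using H \<rho> by (simp add: C_def)
  have *: "Lnorm s \<mu> F \<le> ennreal C * K"
    if F: "F \<in> borel_measurable lebesgue" and a: "\<And>k. a k \<in> borel_measurable lebesgue"
      and le: "\<And>y. F y \<le> ennreal H * (SUP k::nat. ennreal \<theta> ^ k * a k y)"
      and K: "\<And>k. Lnorm s \<mu> (a k) \<le> K" for F K and a :: "nat \<Rightarrow> 'a \<Rightarrow> ennreal"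
  proof -
    note [measurable] = a
    have L: "Lnorm s \<mu> g = epowr (\<integral>\<^sup>+y. epowr (g y) \<sigma> \<partial>wmeasure \<mu>) (1 / \<sigma>)" for g
      using \<sigma> rs real by (simp add: Lnorm_def)
    have [measurable]: "(\<lambda>y. epowr (a k y) \<sigma>) \<in> borel_measurable (wmeasure \<mu>)" for k
      using a by (simp add: wmeasure_def)
    have aK: "(\<integral>\<^sup>+y. epowr (a k y) \<sigma> \<partial>wmeasure \<mu>) \<le> epowr K \<sigma>" for k
      using epowr_mono[OF \<sigma> K[of k, unfolded L]] \<sigma> by (simp add: epowr_epowr)
    have pt: "epowr (F y) \<sigma> \<le> ennreal (H powr \<sigma>) * (\<Sum>k. ennreal (\<rho> ^ k) * epowr (a k y) \<sigma>)" for y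
    proof -
      have "epowr (F y) \<sigma> \<le> epowr (ennreal H * (SUP k. ennreal \<theta> ^ k * a k y)) \<sigma>"
        by (intro epowr_mono \<sigma> le)
      also have "\<dots> = ennreal (H powr \<sigma>) * epowr (SUP k. ennreal \<theta> ^ k * a k y) \<sigma>"
        using H \<sigma> by (simp add: epowr_mult epowr_ennreal)
      also have "\<dots> \<le> ennreal (H powr \<sigma>) * (\<Sum>k. epowr (ennreal \<theta> ^ k * a k y) \<sigma>)"
        by (intro mult_left_mono epowr_SUP_le \<sigma>) auto
      finally have "epowr (F y) \<sigma> \<le> ennreal (H powr \<sigma>) * (\<Sum>k. epowr (ennreal \<theta> ^ k * a k y) \<sigma>)" .
      moreover have "epowr (ennreal \<theta> ^ k * a k y) \<sigma> = ennreal (\<rho> ^ k) * epowr (a k y) \<sigma>" for k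
      proof -
        \<comment> \<open>Induction also covers \<theta> = 0.\<close>
        have "(\<theta> ^ k) powr \<sigma> = \<rho> ^ k"
          using \<theta>(1) by (induction k) (auto simp: \<rho>_def powr_mult)
        then show ?thesis
          using \<sigma> \<theta> by (simp add: epowr_mult ennreal_power epowr_ennreal_nonneg)
      qed
      ultimately show ?thesis by simp
    qed
    have "(\<integral>\<^sup>+y. epowr (F y) \<sigma> \<partial>wmeasure \<mu>) \<le>
        (\<integral>\<^sup>+y. ennreal (H powr \<sigma>) * (\<Sum>k. ennreal (\<rho> ^ k) * epowr (a k y) \<sigma>) \<partial>wmeasure \<mu>)"
      by (intro nn_integral_mono pt)
    also have "\<dots> = ennreal (H powr \<sigma>) * (\<Sum>k. ennreal (\<rho> ^ k) * (\<integral>\<^sup>+y. epowr (a k y) \<sigma> \<partial>wmeasure \<mu>))"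
      by (simp add: nn_integral_cmult nn_integral_suminf)
    also have "\<dots> \<le> ennreal (H powr \<sigma>) * (\<Sum>k. ennreal (\<rho> ^ k) * epowr K \<sigma>)"
      by (intro mult_left_mono suminf_le aK) auto
    also have "(\<Sum>k. ennreal (\<rho> ^ k) * epowr K \<sigma>) = ennreal (1 / (1 - \<rho>)) * epowr K \<sigma>"
      using \<rho> by (simp add: suminf_ennreal_eq[OF _ geometric_sums] suminf_geometric)
    finally have "Lnorm s \<mu> F \<le> epowr (ennreal (H powr \<sigma>) * (ennreal (1 / (1 - \<rho>)) * epowr K \<sigma>)) (1 / \<sigma>)"
      unfolding L using \<sigma> by (intro epowr_mono) auto
    also have "\<dots> = ennreal C * K"
      using \<sigma> \<rho> H
      by (simp add: epowr_mult epowr_ennreal_nonneg epowr_epowr powr_powr C_def ennreal_mult mult_ac)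
    finally show ?thesis .
  qed
  show ?thesis by (rule that[OF C]) (fact *)
qed

section \<open>Consequences of the A(1,q) condition\<close>

text \<open>The truncations to closed balls are integrable and at each point eventually equal to
  \<open>f\<close>.\<close>

lemma locally_integrable_borel_measurable:
  fixes f :: "'a::euclidean_space \<Rightarrow> 'b::{banach,second_countable_topology}"
  assumes "locally_integrable f"
  shows "f \<in> borel_measurable lebesgue"
proof (rule borel_measurable_LIMSEQ_metric)
  fix n :: nat
  show "(\<lambda>x. indicator (cball 0 (real n)) x *\<^sub>R f x) \<in> borel_measurable lebesgue"
    using assms compact_cball[of 0 "real n"] unfolding locally_integrable_def set_integrable_def
    by (blast intro: borel_measurable_integrable)
next
  fix x :: 'a
  obtain N :: nat where N: "norm x \<le> real N" using real_arch_simple by blast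
  have "\<forall>\<^sub>F n in sequentially. indicator (cball 0 (real n)) x *\<^sub>R f x = f x"
    using eventually_ge_at_top[of N] by eventually_elim (use N in \<open>auto simp: indicator_def\<close>)
  then show "(\<lambda>n. indicator (cball 0 (real n)) x *\<^sub>R f x) \<longlonglongrightarrow> f x"
    by (rule tendsto_eventually)
qed

lemma emeasure_wmeasure:
  assumes "v \<in> borel_measurable lebesgue" "E \<in> sets lebesgue"
  shows "emeasure (wmeasure v) E = (\<integral>\<^sup>+x\<in>E. ennreal (v x) \<partial>lebesgue)"
  using assms by (simp add: wmeasure_def emeasure_density)

text \<open>Multiplying by \<open>w\<close> clears the reciprocal and leaves a lower bound for
  \<open>w\<close> almost everywhere on the ball. \<open>A1_class\<close> asks local integrability
  of \<open>w\<close> only; finiteness of w^q dx on balls is read off from this bound.\<close>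

lemma A1_class_AE_le:
  fixes w :: "'a::euclidean_space \<Rightarrow> real"
  assumes w: "w \<in> A1_class q" and q: "1 < q"
  obtains C where "0 < C"
    "\<And>z r. 0 < r \<Longrightarrow> emeasure (wmeasure (\<lambda>x. w x powr q)) (ball z r) < \<infinity>"
    "\<And>z r. 0 < r \<Longrightarrow> AE x in lebesgue. x \<in> ball z r \<longrightarrow>
      epowr (emeasure (wmeasure (\<lambda>x. w x powr q)) (ball z r) / emeasure lebesgue (ball z r)) (1 / q)
        \<le> ennreal (C * w x)"
proof -
  have w0: "0 \<le> w x" for x using w by (auto simp: A1_class_def weight_def)
  have [measurable]: "w \<in> borel_measurable lebesgue"
    using w by (auto simp: A1_class_def weight_def intro: locally_integrable_borel_measurable)
  define X where "X z r = epowr (emeasure (wmeasure (\<lambda>x. w x powr q)) (ball z r) / emeasure lebesgue (ball z r)) (1 / q)"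
    for z r
  obtain C where C: "0 < C" and A1: "\<And>z r. 0 < r \<Longrightarrow>
      X z r * esssup (restrict_space lebesgue (ball z r)) (\<lambda>x. inverse (ennreal (w x))) \<le> ennreal C"
    using w by (auto simp: A1_class_def X_def emeasure_wmeasure)
  have AE: "AE x in lebesgue. x \<in> ball z r \<longrightarrow> X z r \<le> ennreal (C * w x)" if r: "0 < r" for z r
  proof -
    let ?s = "esssup (restrict_space lebesgue (ball z r)) (\<lambda>x. inverse (ennreal (w x)))"
    have "AE x in restrict_space lebesgue (ball z r). inverse (ennreal (w x)) \<le> ?s"
      by (rule esssup_AE)
    then have "AE x in lebesgue. x \<in> ball z r \<longrightarrow> inverse (ennreal (w x)) \<le> ?s"
      by (subst (asm) AE_restrict_space_iff) auto
    then show ?thesis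
    proof eventually_elim
      case (elim x)
      show ?case
      proof
        assume "x \<in> ball z r"
        with elim have "X z r * inverse (ennreal (w x)) \<le> X z r * ?s"
          by (intro mult_left_mono) auto
        with A1[OF r, of z] have le: "X z r * inverse (ennreal (w x)) \<le> ennreal C" by order
        show "X z r \<le> ennreal (C * w x)"
        \<comment> \<open>At a zero of \<open>w\<close> the reciprocal is \<infinity>, so the finite
          bound forces \<open>X z r = 0\<close>.\<close>
        proof (cases "w x = 0")
          case True
          with le show ?thesis by (cases "X z r = 0") (auto simp: ennreal_mult_top top_unique)
        next
          case False
          then have 1: "inverse (ennreal (w x)) * ennreal (w x) = 1"
            using w0[of x] by (simp add: inverse_ennreal flip: ennreal_mult)
          have "X z r = X z r * inverse (ennreal (w x)) * ennreal (w x)"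
            by (simp add: mult.assoc 1)
          also have "\<dots> \<le> ennreal C * ennreal (w x)"
            by (intro mult_right_mono le) auto
          finally show ?thesis using C w0 by (simp add: ennreal_mult)
        qed
      qed
    qed
  qed
  have fin: "emeasure (wmeasure (\<lambda>x. w x powr q)) (ball z r) < \<infinity>" if r: "0 < r" for z r
  proof -
    \<comment> \<open>A ball is not a null set, so the bound holds at some point, and its right side
      is finite there.\<close>
    have "\<exists>x. X z r \<le> ennreal (C * w x)"
    proof (rule ccontr)
      assume "\<not> ?thesis"
      with AE[OF r, of z] have "AE x in lebesgue. x \<notin> ball z r" by auto
      then have "ball z r \<in> null_sets lebesgue"
        by (subst AE_iff_null_sets) auto
      moreover have "0 < unit_ball_vol (real DIM('a)) * r ^ DIM('a)"
        using r by simp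
      ultimately show False
        using r by (auto simp: null_sets_def emeasure_ball ennreal_eq_0_iff not_le)
    qed
    then have "X z r < \<infinity>" by (auto intro: le_less_trans)
    then have "emeasure (wmeasure (\<lambda>x. w x powr q)) (ball z r) \<noteq> top"
      using r q by (auto simp: X_def emeasure_ball ennreal_top_divide)
    then show ?thesis by (simp add: less_top)
  qed
  from C fin AE show ?thesis unfolding X_def by (rule that)
qed

text \<open>The inequality comes from integrating the bound of \<open>A1_class_AE_le\<close> for the larger ball over the
  smaller one. The condition on the total measure excludes the member \<open>w = 0\<close> of the class.\<close>

lemma A1_class_homogeneous_measure:
  fixes w :: "'a::euclidean_space \<Rightarrow> real"
  assumes w: "w \<in> A1_class q" and q: "1 < q"
    and nonzero: "emeasure (wmeasure (\<lambda>x. w x powr q)) UNIV \<noteq> 0"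
  obtains A where "homogeneous_measure (wmeasure (\<lambda>x. w x powr q)) A"
proof -
  define M where "M = wmeasure (\<lambda>x. w x powr q)"
  have w0: "0 \<le> w x" for x using w by (auto simp: A1_class_def weight_def)
  have [measurable]: "w \<in> borel_measurable lebesgue"
    using w by (auto simp: A1_class_def weight_def intro: locally_integrable_borel_measurable)
  have sets_M: "sets M = sets lebesgue" by (simp add: M_def wmeasure_def)
  obtain C where C: "0 < C" and fin: "\<And>z r. 0 < r \<Longrightarrow> emeasure M (ball z r) < \<infinity>"
    and AE: "\<And>z r. 0 < r \<Longrightarrow> AE x in lebesgue. x \<in> ball z r \<longrightarrow>
      epowr (emeasure M (ball z r) / emeasure lebesgue (ball z r)) (1 / q) \<le> ennreal (C * w x)"
    using A1_class_AE_le[OF w q] unfolding M_def by blast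
  define \<kappa> where "\<kappa> = unit_ball_vol (real DIM('a))"
  have \<kappa>: "0 < \<kappa>" by (simp add: \<kappa>_def)
  have Leb: "emeasure lborel (ball z r) = ennreal (\<kappa> * r ^ DIM('a))" if "0 < r" for z :: 'a and r
    using that by (simp add: emeasure_ball \<kappa>_def)
  have eq: "emeasure M (ball z r) = ennreal (measure M (ball z r))" if "0 < r" for z r
    using fin[OF that, of z] by (intro emeasure_eq_ennreal_measure) auto
  have hom: "measure M (ball y r) \<le> C powr q * (r / \<rho>) ^ DIM('a) * measure M (ball z \<rho>)"
    if \<rho>: "0 < \<rho>" and r: "0 < r" and sub: "ball z \<rho> \<subseteq> ball y r" for z y \<rho> r
  proof -
    have [measurable]: "ball z \<rho> \<in> sets lebesgue" by simp
    let ?m = "measure M (ball y r)" and ?m' = "measure M (ball z \<rho>)"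
    \<comment> \<open>The average of w^q over the larger ball; C^q w^q is at least this almost
      everywhere on the smaller one.\<close>
    let ?c = "?m / (\<kappa> * r ^ DIM('a))"
    have c0: "0 \<le> ?c" using \<kappa> r by simp
    have "AE x in lebesgue. ennreal ?c * indicator (ball z \<rho>) x \<le>
        ennreal (C powr q) * (ennreal (w x powr q) * indicator (ball z \<rho>) x)"
      using AE[OF r, of y]
    proof eventually_elim
      case (elim x)
      show ?case
      proof (cases "x \<in> ball z \<rho>")
        case True
        with elim sub have "epowr (emeasure M (ball y r) / emeasure lebesgue (ball y r)) (1 / q) \<le> ennreal (C * w x)"
          by auto
        then have "epowr (ennreal ?c) (1 / q) \<le> ennreal (C * w x)"
          using \<kappa> r by (simp add: eq Leb divide_ennreal)
        from epowr_mono[OF _ this, of q] have "ennreal ?c \<le> ennreal ((C * w x) powr q)"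
          using q C w0 by (simp add: epowr_epowr epowr_ennreal_nonneg)
        with True show ?thesis
          using C w0 by (simp add: powr_mult ennreal_mult)
      qed simp
    qed
    then have "(\<integral>\<^sup>+x. ennreal ?c * indicator (ball z \<rho>) x \<partial>lebesgue) \<le>
        (\<integral>\<^sup>+x. ennreal (C powr q) * (ennreal (w x powr q) * indicator (ball z \<rho>) x) \<partial>lebesgue)"
      by (rule nn_integral_mono_AE)
    also have "\<dots> = ennreal (C powr q) * emeasure M (ball z \<rho>)"
      by (simp add: nn_integral_cmult M_def emeasure_wmeasure)
    also have "(\<integral>\<^sup>+x. ennreal ?c * indicator (ball z \<rho>) x \<partial>lebesgue) = ennreal ?c * ennreal (\<kappa> * \<rho> ^ DIM('a))"
      by (subst nn_integral_cmult_indicator) (use \<rho> in \<open>auto simp: Leb\<close>)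
    finally have "ennreal (?c * (\<kappa> * \<rho> ^ DIM('a))) \<le> ennreal (C powr q * ?m')"
      using \<rho> \<kappa> ennreal_mult'[OF c0, of "\<kappa> * \<rho> ^ DIM('a)"] ennreal_mult'[of "C powr q" ?m']
      by (simp only: eq) simp
    then have "?c * (\<kappa> * \<rho> ^ DIM('a)) \<le> C powr q * ?m'"
      using C by (subst (asm) ennreal_le_iff) auto
    then show ?thesis
      using \<rho> r \<kappa> by (simp add: field_simps power_divide)
  qed
  \<comment> \<open>A null ball would by \<open>hom\<close> make all larger concentric balls null,
    hence the whole space.\<close>
  have pos: "0 < emeasure M (ball z \<rho>)" if \<rho>: "0 < \<rho>" for z \<rho>
  proof (rule ccontr)
    assume "\<not> ?thesis"
    then have "measure M (ball z \<rho>) = 0" by (simp add: measure_def)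
    then have "measure M (ball z (\<rho> + real n)) = 0" for n
      using hom[of \<rho> "\<rho> + real n" z z] \<rho> by (simp add: subset_ball measure_le_0_iff)
    then have null: "emeasure M (ball z (\<rho> + real n)) = 0" for n
      using \<rho> by (simp add: eq)
    have "UNIV = (\<Union>n. ball z (\<rho> + real n))"
    proof -
      have "\<exists>n. dist z x < \<rho> + real n" for x
        using reals_Archimedean2[of "dist z x"] \<rho> by (metis add.commute add_strict_increasing less_imp_le)
      then show ?thesis by auto
    qed
    moreover have "emeasure M (\<Union>n. ball z (\<rho> + real n)) = 0"
      using null by (intro emeasure_UN_eq_0) (auto simp: sets_M)
    ultimately show False using nonzero by (simp add: M_def)
  qed
  have "homogeneous_measure M (C powr q)"
  proof
    show "emeasure M (ball z r) < \<infinity>" for z r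
      using fin[of r z] by (cases "0 < r") (auto simp: ball_empty not_less)
  qed (use sets_M pos hom C in auto)
  then show ?thesis by (intro that) (simp add: M_def)
qed

text \<open>Integrating \<open>g\<close> against the lower bound for \<open>w\<close> gives
  (m/l)^(1/q) I \<le> C P, while \<open>less\<close> gives t l^(1/q) \<le> I. The volume
  \<open>l\<close> cancels because the fractional average and the A(1,q) condition carry it with the
  same power 1/q.\<close>

lemma emeasure_le_of_less_average:
  fixes w :: "'a::euclidean_space \<Rightarrow> real" and g :: "'a \<Rightarrow> ennreal" and q C t r :: real
  defines "M \<equiv> wmeasure (\<lambda>x. w x powr q)"
  assumes [measurable]: "w \<in> borel_measurable lebesgue" "g \<in> borel_measurable lebesgue"
    and w0: "\<And>x. 0 \<le> w x" and q: "1 < q" and C: "0 < C" and t: "0 < t" and r: "0 < r"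
    and fin: "emeasure M (ball z r) < \<infinity>"
    and AE: "AE x in lebesgue. x \<in> ball z r \<longrightarrow>
      epowr (emeasure M (ball z r) / emeasure lebesgue (ball z r)) (1 / q) \<le> ennreal (C * w x)"
    and less: "ennreal t < (\<integral>\<^sup>+x\<in>ball z r. g x \<partial>lebesgue) / epowr (emeasure lebesgue (ball z r)) (1 / q)"
  shows "emeasure M (ball z r) \<le> epowr (ennreal (C / t) * emeasure (density (wmeasure w) g) (ball z r)) q"
proof -
  have [measurable]: "ball z r \<in> sets lebesgue" by simp
  define l m where "l = unit_ball_vol (real DIM('a)) * r ^ DIM('a)" and "m = measure M (ball z r)"
  have l: "0 < l" "emeasure lborel (ball z r) = ennreal l"
    using r by (simp_all add: l_def emeasure_ball)
  have m: "0 \<le> m" "emeasure M (ball z r) = ennreal m"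
    using fin by (simp_all add: m_def emeasure_eq_ennreal_measure)
  define I where "I = (\<integral>\<^sup>+x\<in>ball z r. g x \<partial>lebesgue)"
  define P where "P = emeasure (density (wmeasure w) g) (ball z r)"
  have P: "P = (\<integral>\<^sup>+x. ennreal (w x) * (g x * indicator (ball z r) x) \<partial>lebesgue)"
    unfolding P_def by (subst emeasure_density) (auto simp: wmeasure_def nn_integral_density)
  have X: "epowr (emeasure M (ball z r) / emeasure lebesgue (ball z r)) (1 / q) = ennreal ((m / l) powr (1 / q))"
    using l m q by (simp add: divide_ennreal epowr_ennreal_nonneg)
  have "ennreal ((m / l) powr (1 / q)) * I = (\<integral>\<^sup>+x. ennreal ((m / l) powr (1 / q)) * (g x * indicator (ball z r) x) \<partial>lebesgue)"
    unfolding I_def by (rule nn_integral_cmult[symmetric]) simp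
  also have "\<dots> \<le> (\<integral>\<^sup>+x. ennreal C * (ennreal (w x) * (g x * indicator (ball z r) x)) \<partial>lebesgue)"
  proof (rule nn_integral_mono_AE)
    show "AE x in lebesgue. ennreal ((m / l) powr (1 / q)) * (g x * indicator (ball z r) x) \<le>
        ennreal C * (ennreal (w x) * (g x * indicator (ball z r) x))"
      using AE unfolding X
    proof eventually_elim
      case (elim x)
      then show ?case
        using C w0[of x] mult_right_mono[of "ennreal ((m / l) powr (1 / q))" "ennreal (C * w x)" "g x"]
        by (cases "x \<in> ball z r") (auto simp: ennreal_mult mult_ac)
    qed
  qed
  also have "\<dots> = ennreal C * P"
    unfolding P by (rule nn_integral_cmult) simp
  finally have IP: "ennreal ((m / l) powr (1 / q)) * I \<le> ennreal C * P" .
  have "ennreal t * ennreal (l powr (1 / q)) \<le> I / ennreal (l powr (1 / q)) * ennreal (l powr (1 / q))"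
    using less l by (intro mult_right_mono) (auto simp: I_def epowr_ennreal)
  also have "\<dots> = I"
    using l by (simp add: divide_ennreal_def inverse_ennreal mult.assoc flip: ennreal_mult)
  finally have tI: "ennreal t * ennreal (l powr (1 / q)) \<le> I" .
  have "ennreal (m powr (1 / q)) = ennreal (1 / t) * (ennreal ((m / l) powr (1 / q)) * (ennreal t * ennreal (l powr (1 / q))))"
    using l m t by (simp add: powr_divide flip: ennreal_mult)
  also have "\<dots> \<le> ennreal (1 / t) * (ennreal ((m / l) powr (1 / q)) * I)"
    by (intro mult_left_mono tI) auto
  also have "\<dots> \<le> ennreal (1 / t) * (ennreal C * P)"
    by (intro mult_left_mono IP) auto
  also have "\<dots> = ennreal (C / t) * P"
    using C t by (simp add: mult.assoc[symmetric] flip: ennreal_mult)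
  finally have "epowr (ennreal m) (1 / q) \<le> ennreal (C / t) * P"
    using m q by (simp add: epowr_ennreal_nonneg)
  from epowr_mono[OF _ this, of q] show ?thesis
    using q m by (simp add: epowr_epowr P_def)
qed

section \<open>Measurability of the maximal function and of local weak norms\<close>

text \<open>The supremum is uncentred: a ball that witnesses the inequality at one point does so at
  all of its points.\<close>

lemma open_frac_maximal_greater: "open {x. t < frac_maximal \<gamma> f x}"
proof (rule openI)
  fix x assume "x \<in> {x. t < frac_maximal \<gamma> f x}"
  then obtain z r where zr: "0 < r" "x \<in> ball z r"
    "t < (\<integral>\<^sup>+ y \<in> ball z r. ennreal (norm (f y)) \<partial>lebesgue) / epowr (emeasure lebesgue (ball z r)) (1 - \<gamma> / real DIM('a))"
    by (auto simp: frac_maximal_def less_SUP_iff)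
  have "ball z r \<subseteq> {x. t < frac_maximal \<gamma> f x}"
  proof
    fix u assume "u \<in> ball z r"
    with zr show "u \<in> {x. t < frac_maximal \<gamma> f x}"
      unfolding frac_maximal_def less_SUP_iff mem_Collect_eq by (intro bexI[of _ "(z, r)"]) auto
  qed
  with zr(2) show "\<exists>e>0. ball x e \<subseteq> {x. t < frac_maximal \<gamma> f x}"
    by (meson open_ball open_contains_ball_eq order_trans)
qed

text \<open>The superlevel sets in \<open>y\<close> are unions over all levels \<open>t\<close> of
  open sets; being open, they are Borel although the union is uncountable.\<close>

lemma borel_measurable_WLnorm_ball:
  fixes v :: "'a::euclidean_space \<Rightarrow> real"
  assumes p: "0 < p" and g: "\<And>t. {x. t < g x} \<in> sets lebesgue"
  shows "(\<lambda>y. WLnorm p v (\<lambda>x. g x * indicator (ball y r) x)) \<in> borel_measurable borel"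
proof (rule borel_measurableI_greater)
  fix c :: ennreal
  define S where "S t = {x. ennreal t < g x}" for t
  have S: "{x. ennreal t < g x * indicator (ball y r) x} = S t \<inter> ball y r" if "0 < t" for t y
    using that by (auto simp: S_def indicator_def)
  have less: "c < ennreal t * x \<longleftrightarrow> c / ennreal t < x" if "0 < t" for t x
    using that by (cases c; cases x)
      (auto simp: divide_ennreal ennreal_mult[symmetric] ennreal_less_iff field_simps ennreal_mult_top
        ennreal_top_divide less_top)
  have "{y \<in> space borel. c < WLnorm p v (\<lambda>x. g x * indicator (ball y r) x)} =
      (\<Union>t\<in>{0<..}. {y. epowr (c / ennreal t) p < emeasure (wmeasure v) (S t \<inter> ball y r)})"
    using p by (auto simp: WLnorm_def less_SUP_iff S less epowr_less_iff)
  also have "open \<dots>"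
    using g by (intro open_UN ballI open_emeasure_Int_ball_greater) (auto simp: S_def wmeasure_def)
  finally show "{y \<in> space borel. c < WLnorm p v (\<lambda>x. g x * indicator (ball y r) x)} \<in> sets borel"
    by simp
qed

lemma borel_measurable_lebesgue: "f \<in> borel_measurable borel \<Longrightarrow> f \<in> borel_measurable lebesgue"
  by (simp add: measurable_completion)

section \<open>Reciprocal exponents and special norms\<close>

lemma recip_ennreal: "0 < p \<Longrightarrow> recip (ennreal p) = 1 / p"
  by (simp add: recip_def inverse_ennreal inverse_eq_divide)

lemma recip_less:
  assumes "0 < \<beta>" "ennreal \<beta> < s" shows "recip s < 1 / \<beta>"
proof (cases s)
  case (real \<sigma>)
  with assms have "\<beta> < \<sigma>" by (simp add: ennreal_less_iff)
  with real assms show ?thesis by (simp add: recip_ennreal frac_less2)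
qed (use assms in \<open>simp add: recip_def\<close>)

lemma Lnorm_zero:
  assumes "0 < s" shows "Lnorm s \<mu> (\<lambda>y. 0) = 0"
proof (cases "s = \<infinity>")
  case True
  have "esssup (wmeasure \<mu>) (\<lambda>y. 0 :: ennreal) \<le> 0" by (rule esssup_I) auto
  with True show ?thesis by (simp add: Lnorm_def)
next
  case False
  with assms show ?thesis by (cases s) (auto simp: Lnorm_def recip_ennreal)
qed

text \<open>Makes the local norm of \<open>f\<close> the value of a measure on a ball, as the
  covering argument requires.\<close>

lemma Lnorm_1:
  assumes [measurable]: "w \<in> borel_measurable lebesgue" "g \<in> borel_measurable lebesgue"
    and E: "E \<in> sets lebesgue"
  shows "Lnorm 1 w (\<lambda>x. g x * indicator E x) = emeasure (density (wmeasure w) g) E"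
proof -
  have "recip 1 = 1" using recip_ennreal[of 1] by simp
  then show ?thesis
    using E by (simp add: Lnorm_def emeasure_density wmeasure_def)
qed

lemma WLnorm_null:
  assumes "0 < p" "emeasure (wmeasure v) UNIV = 0" shows "WLnorm p v g = 0"
proof -
  have "emeasure (wmeasure v) E = 0" for E
    using emeasure_mono[of E UNIV "wmeasure v"] assms(2) by (simp add: wmeasure_def)
  with assms(1) show ?thesis by (simp add: WLnorm_def)
qed

section \<open>The norm inequality\<close>

text \<open>\<open>K\<close> stands for the amalgam norm of \<open>f\<close>. It has to bound all
  radii at once, because the estimate at radius \<open>r\<close> draws on the radii 2^k r.\<close>

lemma Lnorm_frac_maximal_le:
  fixes w \<mu> :: "'a::euclidean_space \<Rightarrow> real" and s :: ennreal and q e \<gamma> :: real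
  defines "v \<equiv> \<lambda>x. w x powr q"
  assumes w: "w \<in> A1_class q" and q: "1 < q" "1 / q = 1 - \<gamma> / real DIM('a)"
    and e: "0 < e + 1 / q" and s: "0 < s"
  shows "\<exists>C>0. \<forall>(f :: 'a \<Rightarrow> 'b::{banach,second_countable_topology}) K.
    f \<in> borel_measurable lebesgue \<longrightarrow>
    (\<forall>r>0. Lnorm s \<mu> (\<lambda>y. epowr (emeasure (wmeasure v) (ball y r)) e *
        Lnorm 1 w (\<lambda>x. ennreal (norm (f x)) * indicator (ball y r) x)) \<le> K) \<longrightarrow>
    (\<forall>r>0. Lnorm s \<mu> (\<lambda>y. epowr (emeasure (wmeasure v) (ball y r)) e *
        WLnorm q v (\<lambda>x. frac_maximal \<gamma> f x * indicator (ball y r) x)) \<le> ennreal C * K)"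
proof (cases "emeasure (wmeasure v) UNIV = 0")
  case True
  \<comment> \<open>The power \<open>e\<close> of a null ball may be \<infinity>, but its product
    with the vanishing weak norm is 0.\<close>
  with q s show ?thesis
    by (intro exI[of _ 1]) (simp add: WLnorm_null Lnorm_zero)
next
  case False
  have w0: "0 \<le> w x" for x using w by (auto simp: A1_class_def weight_def)
  have w_meas [measurable]: "w \<in> borel_measurable lebesgue"
    using w by (auto simp: A1_class_def weight_def intro: locally_integrable_borel_measurable)
  define M where "M = wmeasure v"
  obtain A where "homogeneous_measure M A"
    by (rule A1_class_homogeneous_measure[OF w q(1), folded v_def, OF False, folded M_def]) (rule that)
  then interpret homogeneous_measure M A .
  obtain C where C: "0 < C"
    and AE: "\<And>z r. 0 < r \<Longrightarrow> AE x in lebesgue. x \<in> ball z r \<longrightarrow>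
      epowr (emeasure M (ball z r) / emeasure lebesgue (ball z r)) (1 / q) \<le> ennreal (C * w x)"
    by (rule A1_class_AE_le[OF w q(1), folded v_def, folded M_def]) (rule that)
  obtain \<theta> where \<theta>: "0 < \<theta>" "\<theta> < 1"
    "\<And>y r k. 0 < r \<Longrightarrow> measure M (ball y r) \<le> \<theta> ^ k * measure M (ball y (2 ^ k * r))"
    by (rule reverse_doubling) (rule that)
  define G where "G = A * 8 ^ DIM('a) * (1 + A * 5 ^ DIM('a))"
  have G: "0 < G"
    unfolding G_def using A_pos by (intro mult_pos_pos add_pos_pos) auto
  define H where "H = G powr (1 / q) * C"
  have H: "0 < H" using G C by (simp add: H_def)
  \<comment> \<open>The decay rate from \<open>scaled_level_le\<close>; it is below 1 because e +
    1/q is positive.\<close>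
  define \<delta> where "\<delta> = \<theta> powr (e + 1 / q)"
  have \<delta>: "0 \<le> \<delta>" "\<delta> < 1"
    using \<theta> e powr_less_mono2[of "e + 1 / q" \<theta> 1] by (auto simp: \<delta>_def)
  obtain C' where C': "0 < C'"
    "\<And>F a K. F \<in> borel_measurable lebesgue \<Longrightarrow> (\<And>k. a k \<in> borel_measurable lebesgue) \<Longrightarrow>
      (\<And>y. F y \<le> ennreal H * (SUP k::nat. ennreal \<delta> ^ k * a k y)) \<Longrightarrow>
      (\<And>k. Lnorm s \<mu> (a k) \<le> K) \<Longrightarrow> Lnorm s \<mu> F \<le> ennreal C' * K"
    apply (rule Lnorm_le_geometric_SUP[OF s \<delta> H, of \<mu>])
    subgoal premises p by (rule p(1)[OF p(2)]) (fact p(3))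
    done
  show ?thesis
  proof (intro exI[of _ C'] conjI allI impI C'(1))
    fix f :: "'a \<Rightarrow> 'b" and K and r :: real
    assume f: "f \<in> borel_measurable lebesgue" and r: "0 < r"
      and K: "\<forall>r>0. Lnorm s \<mu> (\<lambda>y. epowr (emeasure (wmeasure v) (ball y r)) e *
        Lnorm 1 w (\<lambda>x. ennreal (norm (f x)) * indicator (ball y r) x)) \<le> K"
    define P where "P = density (wmeasure w) (\<lambda>x. ennreal (norm (f x)))"
    have sets_P: "sets P = sets lebesgue" by (simp add: P_def wmeasure_def)
    have nf [measurable]: "(\<lambda>x. ennreal (norm (f x))) \<in> borel_measurable lebesgue"
      using f by measurable
    have L1: "Lnorm 1 w (\<lambda>x. ennreal (norm (f x)) * indicator (ball y r) x) = emeasure P (ball y r)" for y r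
      unfolding P_def by (intro Lnorm_1 w_meas nf) simp
    define F where "F y = epowr (emeasure M (ball y r)) e *
        WLnorm q v (\<lambda>x. frac_maximal \<gamma> f x * indicator (ball y r) x)" for y
    \<comment> \<open>The quantity bounded by \<open>K\<close>, at radius 2^k r.\<close>
    define a where "a k y = epowr (emeasure M (ball y (2 ^ k * r))) e * emeasure P (ball y (2 ^ k * r))" for k y
    note [measurable] = borel_measurable_emeasure_ball[OF sets_M] borel_measurable_emeasure_ball[OF sets_P]
    \<comment> \<open>With all factors moved inside the suprema, one level \<open>t\<close> is
      treated at a time. The \<open>k\<close> found below depends on \<open>t\<close> and
      \<open>y\<close>; the supremum over \<open>k\<close> absorbs this.\<close>
    have "F y \<le> ennreal H * (SUP k. ennreal \<delta> ^ k * a k y)" for y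
      unfolding F_def WLnorm_def SUP_mult_left_ennreal
    proof (rule SUP_least)
      fix t :: real assume "t \<in> {0<..}"
      then have t: "0 < t" by simp
      define S where "S = {x. ennreal t < frac_maximal \<gamma> f x * indicator (ball y r) x}"
      have S: "S \<subseteq> ball y r" by (auto simp: S_def indicator_def split: if_splits)
      have "\<exists>k. emeasure M S * emeasure M (ball y (2 ^ k * r)) \<le>
          ennreal G * emeasure M (ball y r) * epowr (ennreal (C / t) * emeasure P (ball y (2 ^ k * r))) q"
        unfolding G_def
      proof (rule emeasure_mult_dilated_ball_le[OF sets_P q(1) r S])
        fix x assume "x \<in> S"
        with S have "ennreal t < frac_maximal \<gamma> f x"
          by (auto simp: S_def indicator_def split: if_splits)
        then obtain z \<rho> where z: "0 < \<rho>" "x \<in> ball z \<rho>"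
          "ennreal t < (\<integral>\<^sup>+ y \<in> ball z \<rho>. ennreal (norm (f y)) \<partial>lebesgue) / epowr (emeasure lebesgue (ball z \<rho>)) (1 / q)"
          by (auto simp: frac_maximal_def less_SUP_iff q(2))
        have "emeasure M (ball z \<rho>) \<le> epowr (ennreal (C / t) * emeasure P (ball z \<rho>)) q"
          unfolding M_def v_def P_def
          by (rule emeasure_le_of_less_average[OF w_meas nf w0 q(1) C t z(1) _ _ z(3)])
            (use AE[OF z(1)] finite_ball in \<open>auto simp: M_def v_def\<close>)
        with z show "\<exists>z \<rho>. 0 < \<rho> \<and> x \<in> ball z \<rho> \<and>
            emeasure M (ball z \<rho>) \<le> epowr (ennreal (C / t) * emeasure P (ball z \<rho>)) q"
          by blast
      qed
      then obtain k where k: "emeasure M S * emeasure M (ball y (2 ^ k * r)) \<le>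
          ennreal G * emeasure M (ball y r) * epowr (ennreal (C / t) * emeasure P (ball y (2 ^ k * r))) q"
        by blast
      have "epowr (emeasure M (ball y r)) e * (ennreal t * epowr (emeasure M S) (1 / q)) \<le>
          ennreal H * (ennreal \<delta> ^ k * a k y)"
        unfolding H_def \<delta>_def a_def
        using q(1) C G by (intro scaled_level_le[OF _ r e _ t _ \<theta>(1) \<theta>(3)[OF r] k]) auto
      also have "\<dots> \<le> (SUP k. ennreal H * (ennreal \<delta> ^ k * a k y))"
        by (rule SUP_upper) simp
      finally show "epowr (emeasure M (ball y r)) e * (ennreal t *
          epowr (emeasure (wmeasure v) {x. ennreal t < frac_maximal \<gamma> f x * indicator (ball y r) x}) (1 / q)) \<le>
          (SUP k. ennreal H * (ennreal \<delta> ^ k * a k y))"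
        by (simp add: M_def S_def)
    qed
    moreover have "F \<in> borel_measurable lebesgue"
      unfolding F_def
      by (intro borel_measurable_lebesgue borel_measurable_times_ennreal borel_measurable_WLnorm_ball)
        (use q(1) in \<open>auto simp: open_sets_lebesgue open_frac_maximal_greater\<close>)
    moreover have "a k \<in> borel_measurable lebesgue" for k
      unfolding a_def by (intro borel_measurable_lebesgue) measurable
    moreover have "Lnorm s \<mu> (a k) \<le> K" for k
      using K[rule_format, of "2 ^ k * r"] r by (simp add: a_def[abs_def] L1 M_def)
    ultimately have "Lnorm s \<mu> F \<le> ennreal C' * K"
      by (intro C'(2))
    then show "Lnorm s \<mu> (\<lambda>y. epowr (emeasure (wmeasure v) (ball y r)) e *
        WLnorm q v (\<lambda>x. frac_maximal \<gamma> f x * indicator (ball y r) x)) \<le> ennreal C' * K"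
      by (simp add: F_def[abs_def] M_def)
  qed
qed

theorem corollary3p2:
  fixes w \<mu> :: "real ^ 'n \<Rightarrow> real"
    and \<gamma> q \<alpha> \<beta> :: real
    and s :: ennreal
  assumes "0 < \<gamma>" and "\<gamma> < real CARD('n)"
    and "q = real CARD('n) / (real CARD('n) - \<gamma>)"
    and "w \<in> A1_class q"
    and "1 \<le> \<alpha>" and "\<alpha> < \<beta>" and "ennreal \<beta> < s" and "s \<le> \<infinity>"
    and "1 / \<beta> = 1 / \<alpha> - \<gamma> / real CARD('n)"
    and "\<mu> \<in> doubling"
  shows "\<exists>C>0. \<forall>f :: real ^ 'n \<Rightarrow> 'b::{real_normed_field,banach,second_countable_topology}.
    f \<in> amalgam 1 s (ennreal \<alpha>) w (\<lambda>x. w x powr q) \<mu> \<longrightarrow>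
      frac_maximal \<gamma> f \<in> weak_amalgam q s (ennreal \<beta>) (\<lambda>x. w x powr q) \<mu> \<and>
      weak_amalgam_norm q s (ennreal \<beta>) (\<lambda>x. w x powr q) \<mu> (frac_maximal \<gamma> f)
        \<le> ennreal C * amalgam_norm 1 s (ennreal \<alpha>) w (\<lambda>x. w x powr q) \<mu> f"
proof -
  have q: "1 < q" "1 / q = 1 - \<gamma> / real DIM(real ^ 'n)"
    using assms(1-3) by (simp_all add: diff_divide_distrib)
  define e where "e = 1 / \<alpha> - 1 - recip s"
  have pos: "0 < \<alpha>" "0 < \<beta>" using assms(5,6) by auto
  have s: "0 < s" using assms(7) by (auto intro: le_less_trans)
  \<comment> \<open>Passing from \<alpha> to \<beta> and from 1 to \<open>q\<close> lowers both
    reciprocals by \<gamma>/n, so both norms have the same exponent \<open>e\<close>.\<close>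
  have e_\<beta>: "1 / \<beta> - 1 / q - recip s = e"
    using assms(9) q(2) by (simp add: e_def)
  \<comment> \<open>The sum is 1/\<beta> - 1/s, positive since \<beta> < s.\<close>
  have e: "0 < e + 1 / q"
    using recip_less[OF pos(2) assms(7)] e_\<beta> by linarith
  have recips: "recip (ennreal \<alpha>) - recip 1 - recip s = e" "recip (ennreal \<beta>) - 1 / q - recip s = e"
    using pos recip_ennreal[of 1] e_\<beta> by (simp_all add: recip_ennreal e_def)
  obtain C where C: "0 < C"
    and bound: "\<forall>(f :: real ^ 'n \<Rightarrow> 'b) K. f \<in> borel_measurable lebesgue \<longrightarrow>
      (\<forall>r>0. Lnorm s \<mu> (\<lambda>y. epowr (emeasure (wmeasure (\<lambda>x. w x powr q)) (ball y r)) e *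
        Lnorm 1 w (\<lambda>x. ennreal (norm (f x)) * indicator (ball y r) x)) \<le> K) \<longrightarrow>
      (\<forall>r>0. Lnorm s \<mu> (\<lambda>y. epowr (emeasure (wmeasure (\<lambda>x. w x powr q)) (ball y r)) e *
        WLnorm q (\<lambda>x. w x powr q) (\<lambda>x. frac_maximal \<gamma> f x * indicator (ball y r) x)) \<le> ennreal C * K)"
    using Lnorm_frac_maximal_le[OF assms(4) q e s, of \<mu>, where ?'b = 'b] by (elim exE conjE)
  show ?thesis
  proof (intro exI[of _ C] conjI allI impI C)
    fix f :: "real ^ 'n \<Rightarrow> 'b"
    assume "f \<in> amalgam 1 s (ennreal \<alpha>) w (\<lambda>x. w x powr q) \<mu>"
    then have f: "f \<in> borel_measurable lebesgue"
      and fin: "amalgam_norm 1 s (ennreal \<alpha>) w (\<lambda>x. w x powr q) \<mu> f < \<infinity>"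
      by (auto simp: amalgam_def intro: locally_integrable_borel_measurable)
    show le: "weak_amalgam_norm q s (ennreal \<beta>) (\<lambda>x. w x powr q) \<mu> (frac_maximal \<gamma> f)
        \<le> ennreal C * amalgam_norm 1 s (ennreal \<alpha>) w (\<lambda>x. w x powr q) \<mu> f"
      unfolding weak_amalgam_norm_def recips
    \<comment> \<open>The amalgam norm, a supremum over radii, is taken as \<open>K\<close>.\<close>
    proof (rule SUP_least, rule bound[rule_format, OF f])
      fix r :: real assume "0 < r"
      then show "Lnorm s \<mu> (\<lambda>y. epowr (emeasure (wmeasure (\<lambda>x. w x powr q)) (ball y r)) e *
          Lnorm 1 w (\<lambda>x. ennreal (norm (f x)) * indicator (ball y r) x)) \<le>
          amalgam_norm 1 s (ennreal \<alpha>) w (\<lambda>x. w x powr q) \<mu> f"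
        unfolding amalgam_norm_def recips by (intro SUP_upper) simp
    qed simp
    have "frac_maximal \<gamma> f \<in> borel_measurable lebesgue"
      by (rule borel_measurableI_greater) (simp add: open_sets_lebesgue open_frac_maximal_greater)
    moreover have "ennreal C * amalgam_norm 1 s (ennreal \<alpha>) w (\<lambda>x. w x powr q) \<mu> f < \<infinity>"
      using fin by (simp add: ennreal_mult_less_top)
    ultimately show "frac_maximal \<gamma> f \<in> weak_amalgam q s (ennreal \<beta>) (\<lambda>x. w x powr q) \<mu>"
      using le by (auto simp: weak_amalgam_def)
  qed
qed

end
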